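(* Let $\mathcal{A}=\{L_0,\dots,L_n\}$ be a line arrangement in $\mathbb{P}^2_{\mathbb{C}}$, with character torus $\mathbb{T}(\mathcal{A})$. The set of all $t\in\mathbb{T}(\mathcal{A})$ such that the rank one local system $\mathcal{L}_t$ is non-admissible is a finite union of (possibly translated) subtori of $\mathbb{T}(\mathcal{A})$, i.e. of cosets of connected closed algebraic subgroups of $\mathbb{T}(\mathcal{A})$. Moreover, the set of all $t\in\mathbb{T}(\mathcal{A})$ such that $\mathcal{L}_t$ is admissible is a Zariski open subset of $\mathbb{T}(\mathcal{A})$.
   Context: Let $M=\mathbb{P}^2\setminus(L_0\cup\dots\cup L_n)$, where $L_j=\{f_j=0\}$ with $f_j$ a linear form. A class $\alpha\in H^1(M,\mathbb{C})$ is written $\alpha=\sum_{j=0}^n a_j\frac{df_j}{f_j}$ with $a_j\in\mathbb{C}$ and $\sum_{j=0}^n a_j=0$, and is identified with $(a_0,\dots,a_n)$. The character torus is $\mathbb{T}(\mathcal{A})=\mathrm{Hom}(H_1(M,\mathbb{Z}),\mathbb{C}^* )=\{(t_0,\dots,t_n)\in(\mathbb{C}^* )^{n+1}\mid t_0t_1\cdots t_n=1\}$, and $\mathrm{Exp}(\alpha)=(\exp(2\pi\sqrt{-1}\,a_0),\dots,\exp(2\pi\sqrt{-1}\,a_n))\in\mathbb{T}(\mathcal{A})$. For $t\in\mathbb{T}(\mathcal{A})$, $\mathcal{L}_t$ is the rank one local system on $M$ with monodromy $t_j$ around $L_j$. The local system $\mathcal{L}_t$ is admissible if there is a class $\alpha=(a_0,\dots,a_n)\in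 H^1(M,\mathbb{C})$ such that $\mathrm{Exp}(\alpha)=t$, $a_j\notin\mathbb{Z}_{>0}$ for all $j$, and for any point $p\in L_0\cup\dots\cup L_n$ lying on at least $3$ of the lines, $a(p):=\sum_{j:\,p\in L_j}a_j\notin\mathbb{Z}_{>0}$. Otherwise it is non-admissible. *)

theory Defs
  imports "HOL-Analysis.Analysis" "HOL-Algebra.Coset"
begin

text \<open>Points of the complex projective plane are the one-dimensional linear subspaces of
  \<open>\<complex>\<^sup>3\<close>. A linear form is given by its coefficient vector.\<close>

definition proj_plane :: "(complex^3) set set" where
  "proj_plane = {vec.span {v} | v. v \<noteq> 0}"

definition form_eval :: "complex^3 \<Rightarrow> complex^3 \<Rightarrow> complex" where
  "form_eval f x = (\<Sum>i\<in>UNIV. f $ i * x $ i)"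

definition proj_line :: "complex^3 \<Rightarrow> (complex^3) set set" where
  "proj_line f = {p \<in> proj_plane. \<forall>x\<in>p. form_eval f x = 0}"

text \<open>The lines are indexed by an arbitrary (nonempty) finite type \<open>'n\<close>, playing the role of
  \<open>{0,\<dots>,n}\<close>. As \<open>\<A>\<close> is a set with \<open>n + 1\<close> elements, the lines are distinct.\<close>

definition line_arrangement :: "('n::finite \<Rightarrow> complex^3) \<Rightarrow> bool" where
  "line_arrangement f \<longleftrightarrow> (\<forall>j. f j \<noteq> 0) \<and> inj (\<lambda>j. proj_line (f j))"

definition lines_through :: "('n::finite \<Rightarrow> complex^3) \<Rightarrow> (complex^3) set \<Rightarrow> 'n set" where
  "lines_through f p = {j. p \<in> proj_line (f j)}"

text \<open>\<open>H\<^sup>1(M,\<complex>)\<close> for the complement \<open>M\<close> of the lines, where the vector \<open>a\<close> stands for the class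
  of \<open>\<Sum>\<^sub>j a\<^sub>j df\<^sub>j/f\<^sub>j\<close>; and the character torus \<open>Hom(H\<^sub>1(M,\<int>),\<complex>\<^sup>*)\<close>, where the vector
  \<open>t\<close> stands for the character with value \<open>t\<^sub>j\<close> on the meridian of the \<open>j\<close>-th line, and hence
  for the rank one local system \<open>\<L>\<^sub>t\<close>.\<close>

definition cohom1 :: "(complex^'n) set" where
  "cohom1 = {a. (\<Sum>j\<in>UNIV. a $ j) = 0}"

definition char_torus :: "(complex^'n) set" where
  "char_torus = {t. (\<forall>j. t $ j \<noteq> 0) \<and> (\<Prod>j\<in>UNIV. t $ j) = 1}"

definition char_group :: "(complex^'n) monoid" where
  "char_group = \<lparr>carrier = char_torus, monoid.mult = (\<lambda>s t. \<chi> j. s $ j * t $ j), one = (\<chi> j. 1)\<rparr>"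

definition Exp :: "complex^'n \<Rightarrow> complex^'n" where
  "Exp a = (\<chi> j. exp (2 * complex_of_real pi * \<i> * a $ j))"

definition pos_integers :: "complex set" where
  "pos_integers = of_int ` {0<..}"

definition admissible :: "('n::finite \<Rightarrow> complex^3) \<Rightarrow> complex^'n \<Rightarrow> bool" where
  "admissible f t \<longleftrightarrow>
     (\<exists>a\<in>cohom1. Exp a = t \<and> (\<forall>j. a $ j \<notin> pos_integers) \<and>
        (\<forall>p\<in>(\<Union>j. proj_line (f j)). card (lines_through f p) \<ge> 3 \<longrightarrow>
           (\<Sum>j\<in>lines_through f p. a $ j) \<notin> pos_integers))"

inductive polynomial_fun :: "(complex^'n \<Rightarrow> complex) \<Rightarrow> bool" where
  const: "polynomial_fun (\<lambda>x. c)"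
| coord: "polynomial_fun (\<lambda>x. x $ j)"
| add: "polynomial_fun p \<Longrightarrow> polynomial_fun q \<Longrightarrow> polynomial_fun (\<lambda>x. p x + q x)"
| mult: "polynomial_fun p \<Longrightarrow> polynomial_fun q \<Longrightarrow> polynomial_fun (\<lambda>x. p x * q x)"

definition zero_locus :: "(complex^'n \<Rightarrow> complex) set \<Rightarrow> (complex^'n) set" where
  "zero_locus S = {x. \<forall>p\<in>S. p x = 0}"

definition zariski :: "(complex^'n) topology" where
  "zariski = topology (\<lambda>U. \<exists>S. (\<forall>p\<in>S. polynomial_fun p) \<and> U = - zero_locus S)"

lemma istopology_zariski:
  "istopology (\<lambda>U. \<exists>S. (\<forall>p\<in>S. polynomial_fun p) \<and> U = - zero_locus (S :: (complex^'n \<Rightarrow> complex) set))"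
  unfolding istopology_def
proof (intro conjI allI impI)
  fix U V :: "(complex^'n) set"
  assume "\<exists>S. (\<forall>p\<in>S. polynomial_fun p) \<and> U = - zero_locus S"
    and "\<exists>S. (\<forall>p\<in>S. polynomial_fun p) \<and> V = - zero_locus S"
  then obtain S T where S: "\<forall>p\<in>S. polynomial_fun p" "U = - zero_locus S"
    and T: "\<forall>p\<in>T. polynomial_fun p" "V = - zero_locus T" by blast
  let ?R = "{\<lambda>x. p x * q x | p q. p \<in> S \<and> q \<in> T}"
  have "\<forall>p\<in>?R. polynomial_fun p"
    using S(1) T(1) by (auto intro: polynomial_fun.mult)
  moreover have "U \<inter> V = - zero_locus ?R"
    unfolding S(2) T(2) zero_locus_def by (auto, metis mult_eq_0_iff)
  ultimately show "\<exists>S. (\<forall>p\<in>S. polynomial_fun p) \<and> U \<inter> V = - zero_locus S" by blast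
next
  fix K :: "(complex^'n) set set"
  assume "\<forall>U\<in>K. \<exists>S. (\<forall>p\<in>S. polynomial_fun p) \<and> U = - zero_locus S"
  then obtain S where S: "\<And>U. U \<in> K \<Longrightarrow> (\<forall>p\<in>S U. polynomial_fun p) \<and> U = - zero_locus (S U)"
    by metis
  have "(\<Inter>U\<in>K. zero_locus (S U)) = zero_locus (\<Union>U\<in>K. S U)"
    by (auto simp: zero_locus_def)
  moreover have "\<Union>K = - (\<Inter>U\<in>K. zero_locus (S U))"
    using S by blast
  ultimately show "\<exists>S. (\<forall>p\<in>S. polynomial_fun p) \<and> \<Union>K = - zero_locus S"
    using S by (intro exI[of _ "\<Union>U\<in>K. S U"]) auto
qed

lemma openin_zariski:
  "openin zariski U \<longleftrightarrow> (\<exists>S. (\<forall>p\<in>S. polynomial_fun p) \<and> U = - zero_locus S)"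
  unfolding zariski_def by (simp add: topology_inverse' istopology_zariski)

lemma topspace_zariski [simp]: "topspace zariski = UNIV"
proof -
  have "openin zariski (UNIV :: (complex^'n) set)"
    unfolding openin_zariski zero_locus_def
    by (rule exI[of _ "{\<lambda>x. 1}"]) (auto intro: polynomial_fun.const)
  then show ?thesis using openin_subset by blast
qed

lemma closedin_zariski:
  "closedin zariski Z \<longleftrightarrow> (\<exists>S. (\<forall>p\<in>S. polynomial_fun p) \<and> Z = zero_locus S)"
  by (simp add: closedin_def openin_zariski Compl_eq_Diff_UNIV[symmetric])

lemma comm_group_char_group: "comm_group (char_group :: (complex^'n) monoid)"
proof (rule comm_groupI)
  fix x :: "complex^'n" assume x: "x \<in> carrier char_group"
  have "(\<chi> j. inverse (x $ j)) \<in> carrier char_group"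
    using x by (simp add: char_group_def char_torus_def prod_inversef[unfolded comp_def])
  moreover have "(\<chi> j. inverse (x $ j)) \<otimes>\<^bsub>char_group\<^esub> x = \<one>\<^bsub>char_group\<^esub>"
    using x by (simp add: char_group_def char_torus_def vec_eq_iff)
  ultimately show "\<exists>y\<in>carrier char_group. y \<otimes>\<^bsub>char_group\<^esub> x = \<one>\<^bsub>char_group\<^esub>" by blast
qed (auto simp: char_group_def char_torus_def vec_eq_iff prod.distrib mult_ac)

definition torus_zariski :: "(complex^'n) topology" where
  "torus_zariski = subtopology zariski char_torus"

definition subtorus :: "(complex^'n) set \<Rightarrow> bool" where
  "subtorus H \<longleftrightarrow> subgroup H char_group \<and> closedin torus_zariski H \<and> connectedin torus_zariski H"

definition translated_subtorus :: "(complex^'n) set \<Rightarrow> bool" where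
  "translated_subtorus C \<longleftrightarrow>
     (\<exists>t\<in>char_torus. \<exists>H. subtorus H \<and> C = t <#\<^bsub>char_group\<^esub> H)"

end

theory Submission imports Defs begin

text \<open>Whether a logarithm \<open>a\<close> of \<open>t\<close> is obstructed depends only on the sums \<open>a(S)\<close>
  over those of the finitely many relevant index sets \<open>S\<close> for which \<open>t\<^sup>S = 1\<close>: the other sums
  are never integers. So if \<open>W\<close> is the space of classes all of whose sums of the former kind vanish
  and \<open>t\<close> is non-admissible, then the whole coset \<open>t Exp(W)\<close> is non-admissible, because at its
  other points the constraints can only increase. As \<open>W\<close> is defined over the rationals, \<open>Exp(W)\<close>
  is the identity component of the group cut out by the equations \<open>t\<^sup>S = 1\<close>, hence a subtorus of
  finite index in it, and only finitely many cosets occur.\<close>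

section \<open>Integer linear forms and saturated sublattices\<close>

text \<open>The target ring is left open because integer forms are evaluated both on integer
  vectors, in the lattice arguments, and on complex vectors, that is, on logarithms.\<close>

definition int_dot :: "int^'n \<Rightarrow> 'a::comm_ring_1^'n \<Rightarrow> 'a" where
  "int_dot b a = (\<Sum>j\<in>UNIV. of_int (b $ j) * a $ j)"

lemma int_dot_add_right: "int_dot b (x + y) = int_dot b x + int_dot b y"
  by (simp add: int_dot_def distrib_left sum.distrib)

lemma int_dot_diff_right: "int_dot b (x - y) = int_dot b x - int_dot b y"
  by (simp add: int_dot_def right_diff_distrib sum_subtractf)

lemma int_dot_diff_left: "int_dot (b - c) x = int_dot b x - int_dot c x"
  by (simp add: int_dot_def left_diff_distrib sum_subtractf)

lemma int_dot_scale_right: "int_dot b (c *s x) = c * int_dot b x"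
  by (simp add: int_dot_def sum_distrib_left mult_ac)

lemma int_dot_scale_left: "int_dot (c *s b) x = of_int c * int_dot b x"
  by (simp add: int_dot_def sum_distrib_left mult_ac)

lemma int_dot_sum_right: "int_dot b (\<Sum>i\<in>I. x i) = (\<Sum>i\<in>I. int_dot b (x i))"
  unfolding int_dot_def sum_component sum_distrib_left by (rule sum.swap)

lemma int_dot_sum_left: "int_dot (\<Sum>i\<in>I. b i) x = (\<Sum>i\<in>I. int_dot (b i) x)"
  unfolding int_dot_def sum_component of_int_sum sum_distrib_right by (rule sum.swap)

lemma int_dot_of_int: "int_dot b (\<chi> j. of_int (u $ j)) = of_int (int_dot b u)"
  by (simp add: int_dot_def)

lemma int_dot_axis: "int_dot b (axis j 1) = of_int (b $ j)"
proof -
  have "int_dot b (axis j 1) = (\<Sum>i\<in>UNIV. if i = j then of_int (b $ i) else (0::'a))"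
    unfolding int_dot_def by (rule sum.cong) (auto simp: axis_def)
  then show ?thesis by simp
qed

text \<open>The values of \<open>b\<close> on integer vectors form a nonzero ideal of \<int>. Its
  least positive element divides every entry of \<open>b\<close>, and dividing by it leaves a form
  that attains the value 1.\<close>

lemma primitive_multiple:
  fixes b :: "int^'n"
  assumes "b \<noteq> 0"
  obtains g m and v :: "int^'n" where "g > 0" "b = g *s m" "int_dot m v = 1"
proof -
  define P where "P k \<longleftrightarrow> k > 0 \<and> (\<exists>v. int_dot b v = int k)" for k
  have "\<exists>k. P k"
  proof -
    obtain j where j: "b $ j \<noteq> 0" using assms by (auto simp: vec_eq_iff)
    have "int_dot b (sgn (b $ j) *s axis j 1) = int (nat \<bar>b $ j\<bar>)"
      by (simp add: int_dot_scale_right int_dot_axis sgn_if)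
    then show ?thesis unfolding P_def using j by (metis zero_less_abs_iff zero_less_nat_eq)
  qed
  define k where "k = (LEAST k. P k)"
  have "P k" unfolding k_def using \<open>\<exists>k. P k\<close> by (rule LeastI_ex)
  then obtain v where k: "k > 0" and v: "int_dot b v = int k" by (auto simp: P_def)
  have dvd: "int k dvd b $ j" for j
  proof -
    \<comment> \<open>Division with remainder: \<open>w\<close> realizes
      \<open>b $ j mod int k\<close> as a value of \<open>b\<close>, so minimality of
      \<open>k\<close> forces this remainder to be 0.\<close>
    define w where "w = axis j 1 - (b $ j div int k) *s v"
    have w: "int_dot b w = b $ j mod int k"
      by (simp add: w_def int_dot_diff_right int_dot_scale_right int_dot_axis v minus_div_mult_eq_mod)
    have "\<not> P (nat (b $ j mod int k))"
    proof (rule not_less_Least[of _ P, folded k_def])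
      show "nat (b $ j mod int k) < k"
        using k by (simp add: nat_less_iff)
    qed
    then have "b $ j mod int k \<le> 0"
      using w k unfolding P_def by (auto simp: pos_mod_sign)
    then show ?thesis
      using k by (meson dvd_eq_mod_eq_0 of_nat_0_less_iff order_antisym pos_mod_sign)
  qed
  define m where "m = (\<chi> j. b $ j div int k)"
  have b: "b = int k *s m"
    using dvd by (simp add: m_def vec_eq_iff)
  have "int k * int_dot m v = int k"
    using v unfolding b int_dot_scale_left by simp
  then have "int_dot m v = 1" using k by simp
  then show thesis using that[of "int k" m v] k b by simp
qed

text \<open>Here \<open>m 0, \<dots>, m (r - 1)\<close> is a basis of the saturation of the lattice spanned by \<open>B\<close>; the
  biorthogonal \<open>u i\<close> witness that this saturation is a direct summand of \<open>\<int>\<^sup>n\<close>, and \<open>d\<close>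
  annihilates its quotient by the lattice. Such a basis is found by Gram--Schmidt over \<open>\<int>\<close>.\<close>

definition saturation_basis ::
  "(int^'n) set \<Rightarrow> nat \<Rightarrow> int \<Rightarrow> (nat \<Rightarrow> int^'n) \<Rightarrow> (nat \<Rightarrow> int^'n) \<Rightarrow> bool" where
  "saturation_basis B r d m u \<longleftrightarrow> d > 0 \<and>
    (\<forall>i<r. \<forall>j<r. int_dot (m i) (u j) = (if i = j then 1 else 0)) \<and>
    (\<forall>b\<in>B. \<exists>c. b = (\<Sum>i<r. c i *s m i)) \<and>
    (\<forall>i<r. \<forall>a::complex^'n. (\<forall>b\<in>B. int_dot b a \<in> \<int>) \<longrightarrow> of_int d * int_dot (m i) a \<in> \<int>)"

lemma ex_saturation_basis:
  fixes B :: "(int^'n) set"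
  shows "finite B \<Longrightarrow> \<exists>r d m u. saturation_basis B r d m u"
proof (induction rule: finite_induct)
  case empty
  have "saturation_basis {} 0 1 m u" for m u :: "nat \<Rightarrow> int^'n"
    by (simp add: saturation_basis_def)
  then show ?case by blast
next
  case (insert b B)
  then obtain r d m u where basis: "saturation_basis B r d m u" by blast
  then have d: "d > 0"
    and mu: "\<And>i j. i < r \<Longrightarrow> j < r \<Longrightarrow> int_dot (m i) (u j) = (if i = j then 1 else 0)"
    and span: "\<And>b. b \<in> B \<Longrightarrow> \<exists>c. b = (\<Sum>i<r. c i *s m i)"
    and ann: "\<And>i (a::complex^'n). i < r \<Longrightarrow> (\<forall>b\<in>B. int_dot b a \<in> \<int>) \<Longrightarrow> of_int d * int_dot (m i) a \<in> \<int>"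
    unfolding saturation_basis_def by simp_all
  \<comment> \<open>Removing the components along the \<open>m i\<close> makes \<open>b'\<close>
    vanish on every \<open>u j\<close>. If nothing remains, the old basis still serves.\<close>
  define b' where "b' = b - (\<Sum>i<r. int_dot b (u i) *s m i)"
  show ?case
  proof (cases "b' = 0")
    case True
    then have "\<exists>c. b = (\<Sum>i<r. c i *s m i)" unfolding b'_def by auto
    then have "saturation_basis (insert b B) r d m u"
      using basis unfolding saturation_basis_def by simp
    then show ?thesis by blast
  next
    case False
    then obtain g n and v :: "int^'n" where g: "g > 0" and b': "b' = g *s n" and nv: "int_dot n v = 1"
      by (rule primitive_multiple)
    have "int_dot b' (u j) = 0" if "j < r" for j
    proof -
      have "(\<Sum>i<r. int_dot b (u i) * int_dot (m i) (u j)) = (\<Sum>i<r. if i = j then int_dot b (u i) else 0)"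
        using that by (intro sum.cong) (auto simp: mu)
      then show ?thesis
        using that by (simp add: b'_def int_dot_diff_left int_dot_sum_left int_dot_scale_left)
    qed
    then have nu: "int_dot n (u j) = 0" if "j < r" for j
      using that g unfolding b' int_dot_scale_left by simp
    \<comment> \<open>The dual correction: \<open>w\<close> is killed by the old \<open>m j\<close>,
      while \<open>n\<close> keeps the value 1 because it kills every \<open>u i\<close>.\<close>
    define w where "w = v - (\<Sum>i<r. int_dot (m i) v *s u i)"
    have mw: "int_dot (m j) w = 0" if "j < r" for j
    proof -
      have "(\<Sum>i<r. int_dot (m i) v * int_dot (m j) (u i)) = (\<Sum>i<r. if i = j then int_dot (m i) v else 0)"
        using that by (intro sum.cong) (auto simp: mu)
      then show ?thesis
        using that by (simp add: w_def int_dot_diff_right int_dot_sum_right int_dot_scale_right)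
    qed
    have nw: "int_dot n w = 1"
      by (simp add: w_def int_dot_diff_right int_dot_sum_right int_dot_scale_right nu nv)
    define m' u' where "m' = m(r := n)" and "u' = u(r := w)"
    have "int_dot (m' i) (u' j) = (if i = j then 1 else 0)" if "i < Suc r" "j < Suc r" for i j
      using that mu mw nu nw by (auto simp: m'_def u'_def less_Suc_eq)
    moreover have "\<exists>c. x = (\<Sum>i<Suc r. c i *s m' i)" if x: "x \<in> insert b B" for x
    proof (cases "x = b")
      case True
      have "b = (\<Sum>i<Suc r. (if i = r then g else int_dot b (u i)) *s m' i)"
        using b' by (simp add: m'_def b'_def algebra_simps)
      then show ?thesis unfolding True by (rule exI[of _ "\<lambda>i. if i = r then g else int_dot b (u i)"])
    next
      case False
      then obtain c where "x = (\<Sum>i<r. c i *s m i)" using span x by blast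
      \<comment> \<open>The value of \<open>c\<close> at \<open>r\<close> is arbitrary, so it is
        reset to 0.\<close>
      then have "x = (\<Sum>i<Suc r. (c(r := 0)) i *s m' i)" by (simp add: m'_def)
      then show ?thesis by (rule exI[of _ "c(r := 0)"])
    qed
    moreover have "of_int (d * g) * int_dot (m' i) a \<in> \<int>"
      if i: "i < Suc r" and a: "\<forall>x\<in>insert b B. int_dot x a \<in> \<int>" for i and a :: "complex^'n"
    proof (cases "i = r")
      case True
      \<comment> \<open>The factor \<open>g\<close> turns \<open>n\<close> into \<open>b'\<close>;
        the factor \<open>d\<close> makes the values of the old \<open>m i\<close> occurring in
        \<open>b'\<close> integral.\<close>
      have "of_int (d * g) * int_dot n a = of_int d * int_dot b' a"
        by (simp add: b' int_dot_scale_left)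
      also have "\<dots> = of_int d * int_dot b a - (\<Sum>i<r. of_int (int_dot b (u i)) * (of_int d * int_dot (m i) a))"
        by (simp add: b'_def int_dot_diff_left int_dot_sum_left int_dot_scale_left
            right_diff_distrib sum_distrib_left mult_ac)
      also have "\<dots> \<in> \<int>"
        using a by (intro Ints_diff Ints_sum Ints_mult[OF Ints_of_int] ann) auto
      finally show ?thesis using True by (simp add: m'_def)
    next
      case False
      then have "of_int g * (of_int d * int_dot (m i) a) \<in> \<int>"
        using i a by (intro Ints_mult[OF Ints_of_int] ann) auto
      then show ?thesis using False by (simp add: m'_def mult_ac)
    qed
    ultimately have "saturation_basis (insert b B) (Suc r) (d * g) m' u'"
      using d g unfolding saturation_basis_def by simp
    then show ?thesis by blast
  qed
qed

section \<open>Polynomial functions and the Zariski topology\<close>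

lemma polynomial_fun_power: "polynomial_fun p \<Longrightarrow> polynomial_fun (\<lambda>x. p x ^ k)"
  by (induction k) (auto intro: polynomial_fun.intros)

lemma polynomial_fun_prod:
  "finite I \<Longrightarrow> (\<And>i. i \<in> I \<Longrightarrow> polynomial_fun (p i)) \<Longrightarrow> polynomial_fun (\<lambda>x. \<Prod>i\<in>I. p i x)"
  by (induction I rule: finite_induct) (auto intro: polynomial_fun.intros)

lemma polynomial_fun_diff:
  assumes "polynomial_fun p" "polynomial_fun q"
  shows "polynomial_fun (\<lambda>x. p x - q x)"
proof -
  have "polynomial_fun (\<lambda>x. p x + (- 1) * q x)"
    by (intro polynomial_fun.add polynomial_fun.mult[OF polynomial_fun.const] assms)
  then show ?thesis by simp
qed

text \<open>Translations of the torus are diagonal linear maps, so this carries the equations of a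
  subgroup over to its cosets.\<close>

lemma polynomial_fun_diagonal:
  "polynomial_fun p \<Longrightarrow> polynomial_fun (\<lambda>x. p (\<chi> j. c $ j * x $ j))"
  by (induction rule: polynomial_fun.induct) (auto intro: polynomial_fun.intros)

lemma continuous_on_polynomial_fun: "polynomial_fun p \<Longrightarrow> continuous_on UNIV p"
  by (induction rule: polynomial_fun.induct) (auto intro!: continuous_intros)

lemma openin_zariski_imp_open:
  assumes "openin zariski U"
  shows "open U"
proof -
  obtain S where S: "\<forall>p\<in>S. polynomial_fun p" "U = - zero_locus S"
    using assms by (auto simp: openin_zariski)
  have "- U = (\<Inter>p\<in>S. {x. p x = 0})" by (auto simp: S(2) zero_locus_def)
  moreover have "closed {x. p x = 0}" if "p \<in> S" for p
    using continuous_on_polynomial_fun S(1) that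
    by (intro closed_Collect_eq) (auto intro: continuous_on_const)
  ultimately show ?thesis by (simp add: open_closed closed_INT)
qed

text \<open>Polynomials are continuous, so the Zariski topology is coarser than the Euclidean one
  and the identity map transports connectedness.\<close>

lemma connectedin_torus_zariski:
  assumes "connected A" "A \<subseteq> char_torus"
  shows "connectedin torus_zariski A"
proof -
  have "continuous_map euclidean zariski id"
    by (auto simp: continuous_map_def intro: openin_zariski_imp_open)
  then have "connectedin zariski (id ` A)"
    using assms(1) by (intro connectedin_continuous_map_image) auto
  then show ?thesis
    using assms(2) by (simp add: torus_zariski_def connectedin_subtopology)
qed

lemma closedin_torus_zariski:
  fixes C :: "(complex^'n) set"
  shows "closedin torus_zariski C \<longleftrightarrow>
    (\<exists>S. (\<forall>p\<in>S. polynomial_fun p) \<and> C = {t \<in> char_torus. \<forall>p\<in>S. p t = 0})"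
proof -
  have "{t \<in> char_torus. \<forall>p\<in>S. p t = 0} = zero_locus S \<inter> char_torus"
    for S :: "(complex^'n \<Rightarrow> complex) set"
    by (auto simp: zero_locus_def)
  then show ?thesis
    by (auto simp: torus_zariski_def closedin_subtopology closedin_zariski)
qed

lemma topspace_torus_zariski: "topspace torus_zariski = char_torus"
  by (simp add: torus_zariski_def)

section \<open>The exponential map, cosets and characters\<close>

lemma Exp_add: "(\<chi> j. Exp a $ j * Exp b $ j) = Exp (a + b)"
  by (simp add: Exp_def exp_add distrib_left)

lemma l_coset_char_group: "t <#\<^bsub>char_group\<^esub> H = (\<lambda>s. \<chi> j. t $ j * s $ j) ` H"
  by (auto simp: l_coset_def char_group_def)

lemma l_coset_Exp: "Exp a <#\<^bsub>char_group\<^esub> (Exp ` W) = (\<lambda>w. Exp (a + w)) ` W"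
  by (auto simp: l_coset_char_group Exp_add image_iff)

text \<open>A point of the torus lies in the coset iff its translate by the inverse of
  \<open>t\<close> satisfies the equations of \<open>H\<close>; these are pulled back along that
  translation.\<close>

lemma closedin_l_coset:
  assumes t: "t \<in> char_torus" and "closedin torus_zariski H"
  shows "closedin torus_zariski (t <#\<^bsub>char_group\<^esub> H)"
proof -
  obtain S where S: "\<forall>p\<in>S. polynomial_fun p" and H: "H = {t \<in> char_torus. \<forall>p\<in>S. p t = 0}"
    using assms(2) by (auto simp: closedin_torus_zariski)
  define i where "i = (\<chi> j. inverse (t $ j))"
  define T where "T = (\<lambda>p x. p (\<chi> j. i $ j * x $ j)) ` S"
  have inv: "(\<chi> j. i $ j * (t $ j * s $ j)) = s" "(\<chi> j. t $ j * (i $ j * s $ j)) = s" for s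
    using t by (auto simp: i_def vec_eq_iff char_torus_def)
  have mem: "(\<chi> j. x $ j * y $ j) \<in> char_torus" if "x \<in> char_torus" "y \<in> char_torus" for x y :: "complex^'a"
    using that by (auto simp: char_torus_def prod.distrib)
  have i: "i \<in> char_torus"
    using t by (auto simp: i_def char_torus_def prod_inversef[unfolded comp_def])
  have "t <#\<^bsub>char_group\<^esub> H = {x \<in> char_torus. \<forall>p\<in>T. p x = 0}"
  proof (intro equalityI subsetI)
    fix x assume "x \<in> t <#\<^bsub>char_group\<^esub> H"
    then show "x \<in> {x \<in> char_torus. \<forall>p\<in>T. p x = 0}"
      using mem t by (auto simp: l_coset_char_group H T_def inv)
  next
    fix x assume x: "x \<in> {x \<in> char_torus. \<forall>p\<in>T. p x = 0}"
    then have "(\<chi> j. i $ j * x $ j) \<in> H" using mem i by (auto simp: H T_def)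
    then show "x \<in> t <#\<^bsub>char_group\<^esub> H"
      unfolding l_coset_char_group by (rule rev_image_eqI) (simp add: inv)
  qed
  moreover have "\<forall>p\<in>T. polynomial_fun p" using S by (auto simp: T_def polynomial_fun_diagonal)
  ultimately show ?thesis unfolding closedin_torus_zariski by blast
qed

lemma exp_2pi_i_eq_1_iff: "exp (2 * complex_of_real pi * \<i> * z) = 1 \<longleftrightarrow> z \<in> \<int>"
proof
  assume "exp (2 * complex_of_real pi * \<i> * z) = 1"
  then obtain n :: int where "Re (2 * complex_of_real pi * \<i> * z) = 0"
    "Im (2 * complex_of_real pi * \<i> * z) = of_int (2 * n) * pi" by (auto simp: exp_eq_1)
  then have "z = of_int n" by (auto simp: complex_eq_iff)
  then show "z \<in> \<int>" by simp
next
  assume "z \<in> \<int>"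
  then obtain n :: int where "z = of_int n" by (auto elim: Ints_cases)
  then show "exp (2 * complex_of_real pi * \<i> * z) = 1"
    by (auto simp: exp_eq_1)
qed

text \<open>The equation \<open>t\<^sup>b = 1\<close>, cleared of negative exponents.\<close>

definition char_eqn :: "int^'n \<Rightarrow> complex^'n \<Rightarrow> complex" where
  "char_eqn b t = (\<Prod>j\<in>UNIV. t $ j ^ nat (b $ j)) - (\<Prod>j\<in>UNIV. t $ j ^ nat (- b $ j))"

lemma polynomial_fun_char_eqn: "polynomial_fun (char_eqn b)"
  unfolding char_eqn_def
  by (intro polynomial_fun_diff polynomial_fun_prod polynomial_fun_power polynomial_fun.coord) auto

text \<open>At \<open>Exp a\<close> both monomials are exponentials, and their quotient is the
  exponential of \<open>2 * pi * \<i> * int_dot b a\<close>. Equations on the torus thus become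
  integrality conditions on logarithms.\<close>

lemma char_eqn_Exp: "char_eqn b (Exp a) = 0 \<longleftrightarrow> int_dot b a \<in> \<int>"
proof -
  let ?c = "2 * complex_of_real pi * \<i>"
  have pow: "(\<Prod>j\<in>UNIV. Exp a $ j ^ e j) = exp (?c * (\<Sum>j\<in>UNIV. of_nat (e j) * a $ j))" for e
    by (simp add: Exp_def exp_of_nat_mult[symmetric] exp_sum[symmetric] sum_distrib_left mult_ac)
  have "of_int k = complex_of_nat (nat k) - of_nat (nat (- k))" for k
    by (cases "k \<ge> 0") auto
  then have "int_dot b a = (\<Sum>j\<in>UNIV. of_nat (nat (b $ j)) * a $ j) - (\<Sum>j\<in>UNIV. of_nat (nat (- b $ j)) * a $ j)"
    unfolding int_dot_def sum_subtractf[symmetric] left_diff_distrib[symmetric]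
    by metis
  then have "exp (?c * int_dot b a) = 1 \<longleftrightarrow> char_eqn b (Exp a) = 0"
    unfolding char_eqn_def pow by (simp add: right_diff_distrib exp_diff)
  then show ?thesis by (simp add: exp_2pi_i_eq_1_iff)
qed

lemma ex_Exp:
  fixes t :: "complex^'n"
  assumes "\<And>j. t $ j \<noteq> 0"
  obtains a where "t = Exp a"
proof
  show "t = Exp (\<chi> j. ln (t $ j) / (2 * complex_of_real pi * \<i>))"
    using assms by (simp add: Exp_def vec_eq_iff)
qed

lemma int_dot_one: "int_dot (\<chi> j. 1) a = (\<Sum>j\<in>UNIV. a $ j)"
  by (simp add: int_dot_def)

text \<open>The product of the coordinates is the character of the all-ones vector. Logarithms of
  torus points therefore have an integral coordinate sum, but need not lie in
  \<open>cohom1\<close>.\<close>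

lemma Exp_in_char_torus: "Exp a \<in> char_torus \<longleftrightarrow> int_dot (\<chi> j. 1) a \<in> \<int>"
  using char_eqn_Exp[of "\<chi> j. 1" a] by (auto simp: char_torus_def char_eqn_def Exp_def)

lemma Exp_eq_1: "Exp a = (\<chi> j. 1) \<longleftrightarrow> (\<forall>j. a $ j \<in> \<int>)"
  by (simp add: Exp_def vec_eq_iff exp_2pi_i_eq_1_iff)

lemma Exp_add_Ints:
  assumes "\<And>j. k $ j \<in> \<int>"
  shows "Exp (a + k) = Exp a"
  using assms by (simp add: Exp_add[symmetric] Exp_eq_1[THEN iffD2] vec_eq_iff)

section \<open>Subtori as exponentials of rational subspaces\<close>

text \<open>In logarithmic coordinates, the Lie algebra of the group cut out by the characters in
  \<open>B\<close>.\<close>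

definition annihilator :: "(int^'n) set \<Rightarrow> (complex^'n) set" where
  "annihilator B = {a. \<forall>b\<in>B. int_dot b a = 0}"

lemma annihilator_add: "x \<in> annihilator B \<Longrightarrow> y \<in> annihilator B \<Longrightarrow> x + y \<in> annihilator B"
  by (simp add: annihilator_def int_dot_add_right)

lemma annihilator_diff: "x \<in> annihilator B \<Longrightarrow> y \<in> annihilator B \<Longrightarrow> x - y \<in> annihilator B"
  by (simp add: annihilator_def int_dot_diff_right)

lemma annihilator_scale: "x \<in> annihilator B \<Longrightarrow> c *s x \<in> annihilator B"
  by (simp add: annihilator_def int_dot_scale_right)

lemma zero_in_annihilator: "0 \<in> annihilator B"
  by (simp add: annihilator_def int_dot_def)

lemma convex_annihilator:
  fixes B :: "(int^'n) set"
  shows "convex (annihilator B)"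
proof (rule convexI)
  fix x y :: "complex^'n" and u v :: real
  assume "x \<in> annihilator B" "y \<in> annihilator B"
  then have "complex_of_real u *s x + complex_of_real v *s y \<in> annihilator B"
    by (intro annihilator_add annihilator_scale)
  moreover have "complex_of_real u *s x + complex_of_real v *s y = u *\<^sub>R x + v *\<^sub>R y"
    by (simp add: vec_eq_iff scaleR_conv_of_real[where 'a = complex])
  ultimately show "u *\<^sub>R x + v *\<^sub>R y \<in> annihilator B" by simp
qed

lemma continuous_on_Exp: "continuous_on A Exp"
  unfolding Exp_def by (intro continuous_intros)

text \<open>One inclusion is the spanning property. For the other, \<open>d\<close> times
  \<open>m i\<close> is integral on the annihilator, which is stable under complex scaling; a
  nonzero value could be rescaled to 1/2.\<close>

lemma annihilator_saturation_basis:
  fixes B :: "(int^'n) set"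
  assumes basis: "saturation_basis B r d m u"
  shows "annihilator B = {a. \<forall>i<r. int_dot (m i) a = 0}"
proof -
  have d: "d > 0"
    and span: "\<And>b. b \<in> B \<Longrightarrow> \<exists>c. b = (\<Sum>i<r. c i *s m i)"
    and ann: "\<And>i (a::complex^'n). i < r \<Longrightarrow> (\<forall>b\<in>B. int_dot b a \<in> \<int>) \<Longrightarrow> of_int d * int_dot (m i) a \<in> \<int>"
    using basis unfolding saturation_basis_def by simp_all
  have "int_dot (m i) a = 0" if a: "a \<in> annihilator B" and i: "i < r" for a i
  proof (rule ccontr)
    assume nz: "int_dot (m i) a \<noteq> 0"
    define c where "c = 1 / (2 * of_int d * int_dot (m i) a)"
    have "\<forall>b\<in>B. int_dot b (c *s a) \<in> \<int>"
      using annihilator_scale[OF a, of c] by (simp add: annihilator_def)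
    then have "of_int d * int_dot (m i) (c *s a) \<in> \<int>" using ann i by blast
    moreover have "of_int d * int_dot (m i) (c *s a) = 1 / 2"
      using nz d by (simp add: int_dot_scale_right c_def)
    ultimately have "1 / (2 :: complex) \<in> \<int>" by simp
    then show False using fraction_not_in_Ints[where 'a = complex and m = 1 and n = 2] by simp
  qed
  moreover have "a \<in> annihilator B" if "\<forall>i<r. int_dot (m i) a = 0" for a :: "complex^'n"
  proof -
    have "int_dot b a = 0" if "b \<in> B" for b
    proof -
      obtain c where "b = (\<Sum>i<r. c i *s m i)" using \<open>b \<in> B\<close> span by blast
      then show ?thesis
        using \<open>\<forall>i<r. int_dot (m i) a = 0\<close> by (simp add: int_dot_sum_left int_dot_scale_left)
    qed
    then show ?thesis by (simp add: annihilator_def)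
  qed
  ultimately show ?thesis by blast
qed

text \<open>By biorthogonality the values of all \<open>m i\<close> can be prescribed at once. For
  integer values the vector is integral, hence invisible to \<open>Exp\<close>.\<close>

lemma int_dot_saturation_basis_sum:
  fixes a :: "nat \<Rightarrow> complex"
  assumes "saturation_basis B r d m u" "i < r"
  shows "int_dot (m i) (\<Sum>j<r. a j *s (\<chi> l. of_int (u j $ l))) = a i"
proof -
  have "int_dot (m i) (\<Sum>j<r. a j *s (\<chi> l. of_int (u j $ l))) = (\<Sum>j<r. if j = i then a j else 0)"
    unfolding int_dot_sum_right int_dot_scale_right int_dot_of_int
    using assms by (intro sum.cong) (auto simp: saturation_basis_def)
  then show ?thesis using assms(2) by simp
qed

text \<open>The image of a convex set under a continuous homomorphism is connected, and the all-ones
  vector in \<open>B\<close> keeps it inside the torus. It is closed because the saturated forms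
  \<open>m i\<close> cut it out exactly; the forms in \<open>B\<close> may cut out further
  components.\<close>

lemma subtorus_Exp_annihilator:
  fixes B :: "(int^'n) set"
  assumes fin: "finite B" and one: "(\<chi> j. 1) \<in> B"
  shows "subtorus (Exp ` annihilator B)"
proof -
  let ?H = "Exp ` annihilator B"
  have sub: "?H \<subseteq> char_torus"
    using one by (auto simp: Exp_in_char_torus annihilator_def)
  interpret comm_group "char_group :: (complex^'n) monoid" by (rule comm_group_char_group)
  have "subgroup ?H char_group"
  proof (rule subgroupI)
    show "?H \<subseteq> carrier char_group" using sub by (simp add: char_group_def)
    show "?H \<noteq> {}" using zero_in_annihilator by blast
    have mult: "Exp x \<otimes>\<^bsub>char_group\<^esub> Exp y = Exp (x + y)" for x y :: "complex^'n"
      by (simp add: char_group_def Exp_add)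
    show "x \<otimes>\<^bsub>char_group\<^esub> y \<in> ?H" if "x \<in> ?H" "y \<in> ?H" for x y
      using that by (auto simp: mult annihilator_add)
    show "inv\<^bsub>char_group\<^esub> x \<in> ?H" if x: "x \<in> ?H" for x
    proof -
      obtain a where a: "a \<in> annihilator B" "x = Exp a" using x by blast
      have a': "0 - a \<in> annihilator B" using a by (intro annihilator_diff zero_in_annihilator)
      have "Exp (0 - a) \<otimes>\<^bsub>char_group\<^esub> x = \<one>\<^bsub>char_group\<^esub>"
        unfolding a mult by (simp add: char_group_def Exp_def)
      then have "inv\<^bsub>char_group\<^esub> x = Exp (0 - a)"
        using sub a a' by (intro inv_equality) (auto simp: char_group_def)
      then show ?thesis using a' by simp
    qed
  qed
  moreover have "connectedin torus_zariski ?H"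
    using sub by (intro connectedin_torus_zariski connected_continuous_image continuous_on_Exp
        convex_connected convex_annihilator)
  moreover have "closedin torus_zariski ?H"
  proof -
    obtain r d m u where basis: "saturation_basis B r d m u"
      using ex_saturation_basis[OF fin] by blast
    note W = annihilator_saturation_basis[OF basis]
    have "?H = {t \<in> char_torus. \<forall>p \<in> (\<lambda>i. char_eqn (m i)) ` {..<r}. p t = 0}"
    proof (intro equalityI subsetI)
      fix t assume "t \<in> ?H"
      then show "t \<in> {t \<in> char_torus. \<forall>p \<in> (\<lambda>i. char_eqn (m i)) ` {..<r}. p t = 0}"
        using sub by (auto simp: char_eqn_Exp W)
    next
      fix t assume t: "t \<in> {t \<in> char_torus. \<forall>p \<in> (\<lambda>i. char_eqn (m i)) ` {..<r}. p t = 0}"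
      then obtain a where a: "t = Exp a"
        using ex_Exp[of t] by (auto simp: char_torus_def)
      have int: "int_dot (m i) a \<in> \<int>" if "i < r" for i
        using t that by (auto simp: a char_eqn_Exp)
      \<comment> \<open>An integral vector with the same values as \<open>a\<close> under all
        \<open>m i\<close>: subtracting it moves \<open>a\<close> into the annihilator without
        changing \<open>Exp a\<close>.\<close>
      define k where "k = (\<Sum>j<r. int_dot (m j) a *s (\<chi> l. complex_of_int (u j $ l)))"
      have "a - k \<in> annihilator B"
        by (simp add: W int_dot_diff_right k_def int_dot_saturation_basis_sum[OF basis])
      moreover have "Exp (a - k + k) = Exp (a - k)"
        using int by (intro Exp_add_Ints) (auto simp: k_def sum_component intro!: Ints_sum Ints_mult)
      ultimately show "t \<in> ?H" by (simp add: a)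
    qed
    moreover have "\<forall>p \<in> (\<lambda>i. char_eqn (m i)) ` {..<r}. polynomial_fun p"
      by (simp add: polynomial_fun_char_eqn)
    ultimately show ?thesis
      unfolding closedin_torus_zariski by (intro exI conjI)
  qed
  ultimately show ?thesis by (simp add: subtorus_def)
qed

lemma l_coset_Exp_annihilator:
  assumes "w \<in> annihilator B"
  shows "Exp (a + w) <#\<^bsub>char_group\<^esub> (Exp ` annihilator B) = Exp a <#\<^bsub>char_group\<^esub> (Exp ` annihilator B)"
proof -
  have "(+) w ` annihilator B = annihilator B"
  proof (intro equalityI subsetI)
    fix x assume "x \<in> annihilator B"
    then show "x \<in> (+) w ` annihilator B"
      using assms by (intro image_eqI[of _ _ "x - w"]) (auto intro: annihilator_diff)
  qed (use assms in \<open>auto intro: annihilator_add\<close>)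
  then have "(\<lambda>v. Exp (a + v)) ` (+) w ` annihilator B = (\<lambda>v. Exp (a + v)) ` annihilator B" by simp
  then show ?thesis by (simp add: l_coset_Exp image_image add.assoc)
qed

text \<open>Finiteness of the component group of \<open>{t. \<forall>b\<in>B. t\<^sup>b = 1}\<close>: modulo \<open>\<int>\<^sup>n\<close> and
  \<open>annihilator B\<close>, every logarithm is a combination of the \<open>u i\<close> with coefficients in
  \<open>{0, 1/d, \<dots>, (d-1)/d}\<close>.\<close>

lemma finite_cosets_Exp_annihilator:
  fixes B :: "(int^'n) set"
  assumes fin: "finite B"
  shows "finite ((\<lambda>a. Exp a <#\<^bsub>char_group\<^esub> (Exp ` annihilator B)) ` {a. \<forall>b\<in>B. int_dot b a \<in> \<int>})"
    (is "finite (?coset ` ?A)")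
proof -
  obtain r d m u where basis: "saturation_basis B r d m u"
    using ex_saturation_basis[OF fin] by blast
  note W = annihilator_saturation_basis[OF basis]
  have d: "d > 0"
    and ann: "\<And>i (a::complex^'n). i < r \<Longrightarrow> (\<forall>b\<in>B. int_dot b a \<in> \<int>) \<Longrightarrow> of_int d * int_dot (m i) a \<in> \<int>"
    using basis unfolding saturation_basis_def by simp_all
  define lift :: "(nat \<Rightarrow> complex) \<Rightarrow> complex^'n"
    where "lift z = (\<Sum>j<r. z j *s (\<chi> l. of_int (u j $ l)))" for z
  have dot_lift: "int_dot (m i) (lift z) = z i" if "i < r" for i z
    unfolding lift_def by (rule int_dot_saturation_basis_sum[OF basis that])
  have "?coset ` ?A \<subseteq> (\<lambda>c. ?coset (lift (\<lambda>j. of_int (c j) / of_int d))) ` ({..<r} \<rightarrow>\<^sub>E {0..<d})"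
  proof (rule image_subsetI)
    fix a assume a: "a \<in> ?A"
    define n where "n i = \<lfloor>Re (of_int d * int_dot (m i) a)\<rfloor>" for i
    have n: "of_int d * int_dot (m i) a = of_int (n i)" if "i < r" for i
    proof -
      have "of_int d * int_dot (m i) a \<in> \<int>" using ann[OF that] a by blast
      then show ?thesis unfolding n_def by (rule Ints_cases) simp
    qed
    \<comment> \<open>Dividing \<open>n i\<close> by \<open>d\<close> splits \<open>a\<close>: the
      quotients give the integral vector \<open>q\<close>, the remainders over \<open>d\<close> give
      \<open>lift z\<close>, and the rest \<open>w\<close> is killed by every \<open>m i\<close>.
      The restriction places \<open>c\<close> in a finite set of extensional functions.\<close>
    define c where "c = restrict (\<lambda>i. n i mod d) {..<r}"
    define z where "z j = complex_of_int (c j) / of_int d" for j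
    define q where "q = lift (\<lambda>j. of_int (n j div d))"
    define w where "w = a - q - lift z"
    have "int_dot (m i) w = 0" if "i < r" for i
    proof -
      have "of_int (n i) = complex_of_int (n i div d) * of_int d + of_int (n i mod d)"
        unfolding of_int_mult[symmetric] of_int_add[symmetric] by simp
      then have "int_dot (m i) a = of_int (n i div d) + of_int (n i mod d) / of_int d"
        using n[OF that] d by (simp add: field_simps)
      then show ?thesis
        using that by (simp add: w_def q_def z_def c_def int_dot_diff_right dot_lift)
    qed
    then have w: "w \<in> annihilator B" by (simp add: W)
    have "Exp (lift z + w + q) = Exp (lift z + w)"
      by (intro Exp_add_Ints) (auto simp: q_def lift_def sum_component intro!: Ints_sum Ints_mult)
    moreover have "lift z + w + q = a" by (simp add: w_def)
    ultimately have "?coset a = ?coset (lift z)"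
      using l_coset_Exp_annihilator[OF w] by metis
    moreover have "c \<in> {..<r} \<rightarrow>\<^sub>E {0..<d}" using d by (auto simp: c_def)
    ultimately show "?coset a \<in> (\<lambda>c. ?coset (lift (\<lambda>j. of_int (c j) / of_int d))) ` ({..<r} \<rightarrow>\<^sub>E {0..<d})"
      unfolding z_def by blast
  qed
  then show ?thesis by (rule finite_subset) (simp add: finite_PiE)
qed

section \<open>The non-admissible locus\<close>

lemma pos_integers_subset_Ints: "pos_integers \<subseteq> \<int>"
  by (auto simp: pos_integers_def)

text \<open>The relevant index sets are generalized to a finite set of integer forms; their
  indicator vectors are the case applied to the arrangement.\<close>

lemma non_admissible_union_translated_subtori:
  fixes B :: "(int^'n) set"
  assumes fin: "finite B"
  defines "N \<equiv> {t \<in> char_torus. \<not> (\<exists>a\<in>cohom1. Exp a = t \<and> (\<forall>b\<in>B. int_dot b a \<notin> pos_integers))}"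
  shows "\<exists>F. finite F \<and> (\<forall>C\<in>F. translated_subtorus C) \<and> N = \<Union>F"
proof -
  \<comment> \<open>The all-ones vector keeps the annihilator of \<open>R a\<close> inside
    \<open>cohom1\<close>. Which forms of \<open>B\<close> occur depends only on
    \<open>Exp a\<close>.\<close>
  define R where "R a = insert (\<chi> j. 1) {b \<in> B. int_dot b a \<in> \<int>}" for a :: "complex^'n"
  define coset where "coset S a = Exp a <#\<^bsub>char_group\<^esub> (Exp ` annihilator S)" for S and a :: "complex^'n"
  define F where "F = (\<lambda>a. coset (R a) a) ` {a. Exp a \<in> N}"
  have finR: "finite (R a)" for a using fin by (simp add: R_def)
  have RZ: "\<forall>b\<in>R a. int_dot b a \<in> \<int>" if "Exp a \<in> N" for a
    using that by (auto simp: R_def N_def Exp_in_char_torus)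
  \<comment> \<open>Only finitely many sets occur as \<open>R a\<close>, and each contributes
    finitely many cosets since its forms are integral at \<open>a\<close>.\<close>
  have "F \<subseteq> (\<Union>S\<in>insert (\<chi> j. 1) ` Pow B. coset S ` {a. \<forall>b\<in>S. int_dot b a \<in> \<int>})"
    unfolding F_def using RZ by (fastforce simp: R_def)
  moreover have "finite (\<Union>S\<in>insert (\<chi> j. 1) ` Pow B. coset S ` {a. \<forall>b\<in>S. int_dot b a \<in> \<int>})"
    using fin unfolding coset_def
    by (intro finite_UN_I finite_cosets_Exp_annihilator finite_imageI) (auto intro: finite_subset)
  ultimately have "finite F" by (rule finite_subset)
  moreover have "translated_subtorus C" if C: "C \<in> F" for C
  proof -
    obtain a where a: "Exp a \<in> N" "C = coset (R a) a" using C unfolding F_def by blast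
    have "subtorus (Exp ` annihilator (R a))"
      by (rule subtorus_Exp_annihilator[OF finR]) (simp add: R_def)
    then show ?thesis using a unfolding translated_subtorus_def coset_def N_def by blast
  qed
  moreover have "N \<subseteq> \<Union>F"
  proof
    fix t assume t: "t \<in> N"
    then obtain a where a: "t = Exp a" using ex_Exp[of t] by (auto simp: N_def char_torus_def)
    have "t \<in> coset (R a) a"
      unfolding coset_def l_coset_Exp a by (rule image_eqI[of _ _ 0]) (auto intro: zero_in_annihilator)
    then show "t \<in> \<Union>F" using t a by (auto simp: F_def)
  qed
  moreover have "\<Union>F \<subseteq> N"
  proof
    fix s assume "s \<in> \<Union>F"
    then obtain a w where a: "Exp a \<in> N" and w: "w \<in> annihilator (R a)" and s: "s = Exp (a + w)"
      unfolding F_def coset_def l_coset_Exp by blast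
    have w0: "int_dot (\<chi> j. 1) w = 0" using w by (simp add: annihilator_def R_def)
    \<comment> \<open>An unobstructed logarithm \<open>x\<close> of \<open>s\<close> would give one
      of \<open>Exp a\<close>, namely \<open>x - w\<close>: the forms in \<open>R a\<close> agree at
      \<open>x\<close> and \<open>x - w\<close>, and the other forms of \<open>B\<close> are
      non-integral at every logarithm of \<open>Exp a\<close>.\<close>
    show "s \<in> N"
    proof (rule ccontr)
      assume "s \<notin> N"
      moreover have "s \<in> char_torus"
        using a w0 by (simp add: N_def s Exp_in_char_torus int_dot_add_right)
      ultimately obtain x where x: "x \<in> cohom1" "Exp x = s" "\<And>b. b \<in> B \<Longrightarrow> int_dot b x \<notin> pos_integers"
        by (auto simp: N_def)
      have "Exp (x - w) = Exp a"
        using arg_cong[OF x(2), of "\<lambda>y. \<chi> j. y $ j * Exp (- w) $ j"] by (simp add: s Exp_add)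
      moreover have "x - w \<in> cohom1"
        using x(1) w0 by (simp add: cohom1_def int_dot_one sum_subtractf)
      moreover have "int_dot b (x - w) \<notin> pos_integers" if "b \<in> B" for b
      proof (cases "int_dot b a \<in> \<int>")
        case True
        then have "int_dot b w = 0" using w \<open>b \<in> B\<close> by (simp add: annihilator_def R_def)
        then show ?thesis using x(3)[OF that] by (simp add: int_dot_diff_right)
      next
        case False
        then have "int_dot b (x - w) \<notin> \<int>"
          using \<open>Exp (x - w) = Exp a\<close> by (metis char_eqn_Exp)
        then show ?thesis using pos_integers_subset_Ints by blast
      qed
      ultimately show False using a by (auto simp: N_def)
    qed
  qed
  ultimately show ?thesis by blast
qed

lemma closedin_translated_subtorus: "translated_subtorus C \<Longrightarrow> closedin torus_zariski C"
  by (auto simp: translated_subtorus_def subtorus_def closedin_l_coset)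

lemma int_dot_indicator: "int_dot (\<chi> j. if j \<in> S then 1 else 0) a = (\<Sum>j\<in>S. a $ j)"
proof -
  have "int_dot (\<chi> j. if j \<in> S then 1 else 0) a = (\<Sum>j\<in>UNIV. if j \<in> S then a $ j else 0)"
    unfolding int_dot_def by (rule sum.cong) auto
  then show ?thesis by (simp add: sum.If_cases)
qed

theorem theorem3p2:
  fixes f :: "'n::finite \<Rightarrow> complex^3"
  assumes "line_arrangement f"
  shows "(\<exists>F. finite F \<and> (\<forall>C\<in>F. translated_subtorus C) \<and>
            {t \<in> char_torus. \<not> admissible f t} = \<Union>F)
       \<and> openin torus_zariski {t \<in> char_torus. admissible f t}"
proof -
  \<comment> \<open>The singletons encode the conditions on single coordinates, the other sets those
    at multiple points. Passing from points to subsets of the finite type \<open>'n\<close> leaves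
    finitely many conditions.\<close>
  define P where "P = range (\<lambda>j. {j}) \<union>
    lines_through f ` {p \<in> (\<Union>j. proj_line (f j)). card (lines_through f p) \<ge> 3}"
  define B :: "(int^'n) set" where "B = (\<lambda>S. \<chi> j. if j \<in> S then 1 else 0) ` P"
  have "admissible f t \<longleftrightarrow> (\<exists>a\<in>cohom1. Exp a = t \<and> (\<forall>b\<in>B. int_dot b a \<notin> pos_integers))" for t
    unfolding admissible_def B_def ball_simps int_dot_indicator P_def ball_Un by auto
  moreover have "finite B" by (simp add: B_def)
  ultimately obtain F where F: "finite F" "\<forall>C\<in>F. translated_subtorus C"
    "{t \<in> char_torus. \<not> admissible f t} = \<Union>F"
    using non_admissible_union_translated_subtori[of B] by auto
  have "closedin torus_zariski (\<Union>F)"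
    using F by (intro closedin_Union) (auto intro: closedin_translated_subtorus)
  then have "openin torus_zariski (char_torus - \<Union>F)"
    by (simp add: closedin_def topspace_torus_zariski)
  moreover have "char_torus - \<Union>F = {t \<in> char_torus. admissible f t}"
    unfolding F(3)[symmetric] by blast
  ultimately show ?thesis using F by auto
qed

end
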